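(* Let $R$ be a ring. Then the following are equivalent: (1) $R$ is a uniquely clean ring; (2) $R$ is a strongly $\Delta$-clean ring and all idempotents of $R$ are central.
   Context: Rings are associative with identity, not necessarily commutative. $U(R)$ is the group of units of $R$. Define $\Delta(R)=\{x\in R \mid 1-xu\in U(R)\text{ for all }u\in U(R)\}$. A ring $R$ is strongly $\Delta$-clean if every $a\in R$ can be written $a=e+d$ with $e^2=e\in R$, $d\in\Delta(R)$ and $ed=de$. A ring $R$ is uniquely clean if each element of $R$ has a unique representation as the sum of an idempotent and a unit. *)

theory Defs
  imports "HOL-Algebra.Ring"
begin

text \<open>
  The locale \<^locale>\<open>ring\<close> is that of associative rings with identity; commutativity is not
  assumed and the zero ring is allowed. The group of units is \<^const>\<open>Units\<close>.
\<close>

definition idempotents :: "('a, 'b) ring_scheme \<Rightarrow> 'a set" where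
  "idempotents R = {e \<in> carrier R. e \<otimes>\<^bsub>R\<^esub> e = e}"

definition Delta :: "('a, 'b) ring_scheme \<Rightarrow> 'a set" where
  "Delta R = {x \<in> carrier R. \<forall>u \<in> Units R. \<one>\<^bsub>R\<^esub> \<ominus>\<^bsub>R\<^esub> x \<otimes>\<^bsub>R\<^esub> u \<in> Units R}"

definition strongly_Delta_clean :: "('a, 'b) ring_scheme \<Rightarrow> bool" where
  "strongly_Delta_clean R \<longleftrightarrow>
     (\<forall>a \<in> carrier R. \<exists>e \<in> idempotents R. \<exists>d \<in> Delta R.
        a = e \<oplus>\<^bsub>R\<^esub> d \<and> e \<otimes>\<^bsub>R\<^esub> d = d \<otimes>\<^bsub>R\<^esub> e)"

definition uniquely_clean :: "('a, 'b) ring_scheme \<Rightarrow> bool" where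
  "uniquely_clean R \<longleftrightarrow>
     (\<forall>a \<in> carrier R. \<exists>!p. p \<in> idempotents R \<times> Units R \<and> a = fst p \<oplus>\<^bsub>R\<^esub> snd p)"

definition ring_center :: "('a, 'b) ring_scheme \<Rightarrow> 'a set" where
  "ring_center R = {z \<in> carrier R. \<forall>x \<in> carrier R. z \<otimes>\<^bsub>R\<^esub> x = x \<otimes>\<^bsub>R\<^esub> z}"

end

theory Submission
  imports Defs
begin

text \<open>
  Membership in \<open>\<Delta>(R)\<close> means that adding any unit gives a unit; hence \<open>\<Delta>(R)\<close> is a subring that
  is stable under multiplication by units and whose only idempotent is 0.

  If \<open>R\<close> is uniquely clean, then for an idempotent \<open>e\<close> and \<open>x = e r (1 - e)\<close> the two decompositions
  \<open>e + (1 + x) = (e + x) + 1\<close> force \<open>x = 0\<close>, so idempotents are central. For units \<open>u\<close>, \<open>v\<close> write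
  \<open>u + v = g + t\<close>. In the corner cut out by \<open>p = 1 - g\<close> a sum of two units is a unit, which
  contradicts uniqueness unless \<open>p = 0\<close>; so \<open>u + v - 1\<close> is a unit and sums of two units lie in
  \<open>\<Delta>(R)\<close>. Now \<open>a = f + u\<close> becomes \<open>a = (1 - f) + ((2 f - 1) + u)\<close>.

  Conversely, \<open>a = e + d\<close> becomes \<open>a = (1 - e) + ((2 e - 1) + d)\<close>, which is clean. Every unit lies in
  \<open>1 + \<Delta>(R)\<close>, so if \<open>e + u = f + v\<close>, then \<open>x = e - f\<close> is in \<open>\<Delta>(R)\<close>, whence the idempotent \<open>x\<^sup>2\<close> is 0 and
  \<open>x = x\<^sup>3 = 0\<close>.
\<close>

context ring
begin

text \<open>Sorting summands can leave other terms between \<open>x\<close> and \<open>\<ominus> x\<close>.\<close>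

lemma add_cancel_neg:
  assumes "x \<in> carrier R" "y \<in> carrier R" "z \<in> carrier R"
  shows "x \<oplus> (y \<oplus> \<ominus> x) = y" "\<ominus> x \<oplus> (y \<oplus> x) = y"
    and "x \<oplus> (y \<oplus> (\<ominus> x \<oplus> z)) = y \<oplus> z" "\<ominus> x \<oplus> (y \<oplus> (x \<oplus> z)) = y \<oplus> z"
  using assms a_lcomm[of x y] a_lcomm[of "\<ominus> x" y] by (simp_all add: r_neg l_neg r_neg1 r_neg2)

text \<open>As simp rules these expand products, push negation down to monomials, sort sums and
  cancel opposite terms. Factors are only reassociated, never permuted.\<close>

lemmas ring_normalize = a_minus_def l_distr r_distr l_minus r_minus a_ac m_assoc minus_add
  r_neg l_neg r_neg1 r_neg2 add_cancel_neg

lemma minus_eq_zero_imp_eq: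
  assumes "x \<in> carrier R" "y \<in> carrier R" "x \<ominus> y = \<zero>"
  shows "x = y"
proof -
  have "\<ominus> (\<ominus> y) = x" using assms by (intro minus_equality) (simp_all add: a_minus_def)
  then show ?thesis using assms(2) by simp
qed

section \<open>Units and idempotents\<close>

lemma Units_a_inv:
  assumes "u \<in> Units R"
  shows "\<ominus> u \<in> Units R"
proof -
  obtain v where v: "v \<in> carrier R" "u \<otimes> v = \<one>" "v \<otimes> u = \<one>"
    using assms by (auto simp: Units_def)
  have u: "u \<in> carrier R" using assms by (rule Units_closed)
  have "\<ominus> u \<otimes> \<ominus> v = \<one>" "\<ominus> v \<otimes> \<ominus> u = \<one>"
    using u v by (simp_all add: l_minus r_minus)
  then show ?thesis using u v by (auto simp: Units_def)
qed

lemma Units_idempotent_eq_one: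
  assumes "e \<in> idempotents R" "e \<in> Units R"
  shows "e = \<one>"
proof -
  \<comment> \<open>Idempotency takes the form \<open>e \<otimes> e = e \<otimes> \<one>\<close> so
    that the unit \<open>e\<close> cancels on the left.\<close>
  have e: "e \<in> carrier R" "e \<otimes> e = e \<otimes> \<one>" using assms by (auto simp: idempotents_def)
  then show ?thesis using Units_l_cancel[OF assms(2) e(1) one_closed] by simp
qed

lemma one_minus_idempotent:
  assumes "e \<in> idempotents R"
  shows "\<one> \<ominus> e \<in> idempotents R"
  using assms by (auto simp: idempotents_def a_minus_def l_distr r_distr l_minus r_minus r_neg)

text \<open>The element is its own inverse, as
  \<open>(2 e - 1)^2 = 4 e^2 - 4 e + 1 = 1\<close>.\<close>

lemma two_idempotent_minus_one_Units:
  assumes "e \<in> idempotents R"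
  shows "e \<oplus> e \<ominus> \<one> \<in> Units R"
proof -
  have e: "e \<in> carrier R" "e \<otimes> e = e" using assms by (auto simp: idempotents_def)
  have "(e \<oplus> e \<ominus> \<one>) \<otimes> (e \<oplus> e \<ominus> \<one>) = (e \<otimes> e \<oplus> e \<otimes> e \<oplus> (e \<otimes> e \<oplus> e \<otimes> e)) \<ominus> (e \<oplus> e) \<ominus> (e \<oplus> e) \<oplus> \<one>"
    using e(1) by (simp add: ring_normalize)
  also have "\<dots> = \<one>" unfolding e(2) using e(1) by (simp add: ring_normalize)
  finally show ?thesis using e(1) by (auto simp: Units_def)
qed

text \<open>The inverse is \<open>\<one> \<ominus> x\<close>: both products are
  \<open>\<one> \<ominus> x \<otimes> x\<close>.\<close>

lemma one_plus_square_zero_Units: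
  assumes "x \<in> carrier R" "x \<otimes> x = \<zero>"
  shows "\<one> \<oplus> x \<in> Units R"
proof -
  have "(\<one> \<oplus> x) \<otimes> (\<one> \<ominus> x) = \<one> \<ominus> x \<otimes> x" "(\<one> \<ominus> x) \<otimes> (\<one> \<oplus> x) = \<one> \<ominus> x \<otimes> x"
    using assms(1) by (simp_all add: ring_normalize)
  then have "(\<one> \<oplus> x) \<otimes> (\<one> \<ominus> x) = \<one>" "(\<one> \<ominus> x) \<otimes> (\<one> \<oplus> x) = \<one>"
    using assms by (simp_all add: a_minus_def)
  then show ?thesis using assms(1) by (auto simp: Units_def intro!: bexI[of _ "\<one> \<ominus> x"])
qed

text \<open>A central idempotent splits the ring as \<open>p R \<times> (1 - p) R\<close>. The
  element is \<open>u\<close> in the first factor and 1 in the second, so its inverse arises from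
  \<open>inv u\<close> in the same way.\<close>

lemma central_corner_Units:
  assumes "p \<in> idempotents R" "p \<in> ring_center R" "u \<in> Units R"
  shows "p \<otimes> u \<oplus> (\<one> \<ominus> p) \<in> Units R"
proof -
  have p: "p \<in> carrier R" "p \<otimes> p = p" and pc: "\<And>x. x \<in> carrier R \<Longrightarrow> x \<otimes> p = p \<otimes> x"
    using assms by (auto simp: idempotents_def ring_center_def)
  \<comment> \<open>Only \<open>x \<otimes> y = \<one>\<close> is assumed, so exchanging
    \<open>u\<close> and \<open>inv u\<close> gives both products.\<close>
  have *: "(p \<otimes> x \<oplus> (\<one> \<ominus> p)) \<otimes> (p \<otimes> y \<oplus> (\<one> \<ominus> p)) = \<one>"
    if x: "x \<in> carrier R" and y: "y \<in> carrier R" and xy: "x \<otimes> y = \<one>" for x y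
  proof -
    have 1: "p \<otimes> x \<otimes> (p \<otimes> y) = p"
      using p x y xy by (metis m_assoc m_closed pc r_one)
    have 2: "p \<otimes> x \<otimes> p = p \<otimes> x"
      using p x by (metis m_assoc pc)
    have 3: "p \<otimes> (p \<otimes> y) = p \<otimes> y"
      using p y by (metis m_assoc)
    have "(p \<otimes> x \<oplus> (\<one> \<ominus> p)) \<otimes> (p \<otimes> y \<oplus> (\<one> \<ominus> p)) =
        p \<otimes> x \<otimes> (p \<otimes> y) \<oplus> (p \<otimes> x \<ominus> p \<otimes> x \<otimes> p) \<oplus> (p \<otimes> y \<ominus> p \<otimes> (p \<otimes> y)) \<oplus> (\<one> \<ominus> p \<ominus> p \<oplus> p \<otimes> p)"
      using p(1) x y by (simp add: ring_normalize)
    also have "\<dots> = \<one>"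
      unfolding 1 2 3 p(2) using p(1) x y by (simp add: ring_normalize)
    finally show ?thesis .
  qed
  have "u \<in> carrier R" "inv u \<in> carrier R" "u \<otimes> inv u = \<one>" "inv u \<otimes> u = \<one>"
    using assms(3) by auto
  then show ?thesis using *[of u "inv u"] *[of "inv u" u] p(1)
    by (auto simp: Units_def intro!: bexI[of _ "p \<otimes> inv u \<oplus> (\<one> \<ominus> p)"])
qed

text \<open>The conditions on \<open>x\<close> are symmetric so as to cover both off-diagonal Peirce
  corners, \<open>e R (1 - e)\<close> and \<open>(1 - e) R e\<close>.\<close>

lemma idempotent_plus_corner:
  assumes "e \<in> idempotents R" "x \<in> carrier R"
    and "e \<otimes> x \<oplus> x \<otimes> e = x" "x \<otimes> x = \<zero>"
  shows "e \<oplus> x \<in> idempotents R"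
proof -
  have e: "e \<in> carrier R" "e \<otimes> e = e" using assms by (auto simp: idempotents_def)
  have "(e \<oplus> x) \<otimes> (e \<oplus> x) = e \<otimes> e \<oplus> (e \<otimes> x \<oplus> x \<otimes> e) \<oplus> x \<otimes> x"
    using e(1) assms(2) by (simp add: ring_normalize)
  also have "\<dots> = e \<oplus> x" using assms e by simp
  finally show ?thesis using e assms(2) by (simp add: idempotents_def)
qed

section \<open>Closure properties of \<open>Delta R\<close> and its idempotents\<close>

lemma Delta_iff_add_Units:
  "x \<in> Delta R \<longleftrightarrow> x \<in> carrier R \<and> (\<forall>u \<in> Units R. x \<oplus> u \<in> Units R)"
proof (intro iffI conjI ballI)
  assume x: "x \<in> Delta R"
  then show xc: "x \<in> carrier R" by (simp add: Delta_def)
  fix u assume u: "u \<in> Units R"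
  \<comment> \<open>Testing \<open>x\<close> against the unit \<open>\<ominus> (inv u)\<close> gives
    \<open>1 + x (inv u)\<close>; multiplying by \<open>u\<close> turns this into
    \<open>x + u\<close>.\<close>
  have "\<one> \<ominus> x \<otimes> (\<ominus> (inv u)) \<in> Units R"
    using x u by (auto simp: Delta_def intro: Units_a_inv)
  then have "(\<one> \<ominus> x \<otimes> (\<ominus> (inv u))) \<otimes> u \<in> Units R" using u by blast
  moreover have "(\<one> \<ominus> x \<otimes> (\<ominus> (inv u))) \<otimes> u = x \<otimes> (inv u \<otimes> u) \<oplus> u"
    using xc Units_closed[OF u] Units_inv_closed[OF u] by (simp add: ring_normalize)
  ultimately show "x \<oplus> u \<in> Units R" using u xc by simp
next
  assume x: "x \<in> carrier R \<and> (\<forall>u \<in> Units R. x \<oplus> u \<in> Units R)"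
  have "\<one> \<ominus> x \<otimes> u \<in> Units R" if u: "u \<in> Units R" for u
  proof -
    \<comment> \<open>Conversely \<open>1 - x u\<close> factors as \<open>-(x - inv u) u\<close>, a
      product of units.\<close>
    have "\<ominus> (x \<oplus> \<ominus> (inv u)) \<otimes> u \<in> Units R"
      using x u by (blast intro: Units_a_inv)
    moreover have "\<ominus> (x \<oplus> \<ominus> (inv u)) \<otimes> u = inv u \<otimes> u \<ominus> x \<otimes> u"
      using x Units_closed[OF u] Units_inv_closed[OF u] by (simp add: ring_normalize)
    ultimately show ?thesis using u by simp
  qed
  then show "x \<in> Delta R" using x by (simp add: Delta_def)
qed

lemma Delta_closed: "x \<in> Delta R \<Longrightarrow> x \<in> carrier R"
  by (simp add: Delta_def)

lemma Delta_add_Units: "x \<in> Delta R \<Longrightarrow> u \<in> Units R \<Longrightarrow> x \<oplus> u \<in> Units R"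
  by (simp add: Delta_iff_add_Units)

lemma Delta_a_inv:
  assumes "x \<in> Delta R"
  shows "\<ominus> x \<in> Delta R"
  unfolding Delta_iff_add_Units
proof (intro conjI ballI)
  show "\<ominus> x \<in> carrier R" using assms by (simp add: Delta_closed)
  fix u assume u: "u \<in> Units R"
  have "\<ominus> (x \<oplus> \<ominus> u) \<in> Units R" using assms u by (blast intro: Units_a_inv Delta_add_Units)
  moreover have "\<ominus> (x \<oplus> \<ominus> u) = \<ominus> x \<oplus> u"
    using Delta_closed[OF assms] Units_closed[OF u] by (simp add: ring_normalize)
  ultimately show "\<ominus> x \<oplus> u \<in> Units R" by simp
qed

lemma Delta_add:
  assumes "x \<in> Delta R" "y \<in> Delta R"
  shows "x \<oplus> y \<in> Delta R"
  using assms by (auto simp: Delta_iff_add_Units a_assoc Units_closed)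

lemma Delta_minus: "x \<in> Delta R \<Longrightarrow> y \<in> Delta R \<Longrightarrow> x \<ominus> y \<in> Delta R"
  by (simp add: a_minus_def Delta_add Delta_a_inv)

lemma Delta_mult_Units:
  assumes "x \<in> Delta R" "u \<in> Units R"
  shows "x \<otimes> u \<in> Delta R"
  using assms by (auto simp: Delta_def m_assoc Units_closed)

text \<open>Since \<open>y \<oplus> \<one>\<close> is a unit, \<open>x y = x (y + 1) - x\<close>
  reduces products to multiplication by units and differences.\<close>

lemma Delta_mult:
  assumes "x \<in> Delta R" "y \<in> Delta R"
  shows "x \<otimes> y \<in> Delta R"
proof -
  have "x \<otimes> (y \<oplus> \<one>) \<ominus> x \<in> Delta R"
    using assms by (intro Delta_minus Delta_mult_Units Delta_add_Units) auto
  moreover have "x \<otimes> (y \<oplus> \<one>) \<ominus> x = x \<otimes> y"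
    using assms[THEN Delta_closed] by (simp add: ring_normalize)
  ultimately show ?thesis by simp
qed

text \<open>The complement \<open>\<one> \<ominus> e\<close> is both idempotent and a unit, hence
  1.\<close>

lemma Delta_idempotent_eq_zero:
  assumes "e \<in> idempotents R" "e \<in> Delta R"
  shows "e = \<zero>"
proof -
  have e: "e \<in> carrier R" using assms(2) by (rule Delta_closed)
  have "\<one> \<ominus> e \<in> Units R"
    using Delta_add_Units[OF Delta_a_inv[OF assms(2)] Units_one_closed] e
    by (simp add: a_minus_def a_comm)
  then have 1: "\<one> \<ominus> e = \<one>"
    using Units_idempotent_eq_one one_minus_idempotent assms(1) by blast
  have "e = \<one> \<ominus> (\<one> \<ominus> e)" using e by (simp add: ring_normalize)
  also have "\<dots> = \<zero>" unfolding 1 by (simp add: a_minus_def r_neg)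
  finally show ?thesis .
qed

text \<open>For commuting idempotents the difference \<open>x\<close> satisfies
  \<open>x^3 = x\<close>. So \<open>x^2\<close> is an idempotent in \<open>Delta R\<close> and
  vanishes, and with it \<open>x = x^2 x\<close>.\<close>

lemma commuting_idempotents_eq:
  assumes "e \<in> idempotents R" "f \<in> idempotents R" "e \<otimes> f = f \<otimes> e" "e \<ominus> f \<in> Delta R"
  shows "e = f"
proof -
  have ef: "e \<in> carrier R" "f \<in> carrier R" "e \<otimes> e = e" "f \<otimes> f = f"
    using assms by (auto simp: idempotents_def)
  define x where "x = e \<ominus> f"
  have x: "x \<in> carrier R" using ef by (simp add: x_def)
  have "x \<otimes> x = e \<otimes> e \<ominus> e \<otimes> f \<ominus> f \<otimes> e \<oplus> f \<otimes> f" unfolding x_def using ef(1,2) by (simp add: ring_normalize)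
  then have sq: "x \<otimes> x = e \<ominus> e \<otimes> f \<ominus> e \<otimes> f \<oplus> f" using ef assms(3) by simp
  have "x \<otimes> x \<otimes> x = e \<otimes> e \<ominus> e \<otimes> f \<ominus> e \<otimes> (f \<otimes> e) \<oplus> e \<otimes> (f \<otimes> f) \<ominus> e \<otimes> (f \<otimes> e) \<oplus> e \<otimes> (f \<otimes> f) \<oplus> f \<otimes> e \<ominus> f \<otimes> f"
    unfolding sq unfolding x_def using ef(1,2) by (simp add: ring_normalize)
  also have "e \<otimes> (f \<otimes> e) = e \<otimes> f"
    using ef assms(3) by (metis m_assoc)
  also have "e \<otimes> e \<ominus> e \<otimes> f \<ominus> e \<otimes> f \<oplus> e \<otimes> (f \<otimes> f) \<ominus> e \<otimes> f \<oplus> e \<otimes> (f \<otimes> f) \<oplus> f \<otimes> e \<ominus> f \<otimes> f = x"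
    unfolding ef(3,4) assms(3)[symmetric] x_def using ef(1,2) by (simp add: ring_normalize)
  finally have cube: "x \<otimes> x \<otimes> x = x" .
  have "x \<otimes> x \<in> idempotents R"
    using cube x by (simp add: idempotents_def m_assoc[symmetric])
  moreover have "x \<otimes> x \<in> Delta R" using assms(4) by (simp add: x_def Delta_mult)
  ultimately have "x \<otimes> x = \<zero>" by (rule Delta_idempotent_eq_zero)
  then have "e \<ominus> f = \<zero>" using cube x unfolding x_def by simp
  then show ?thesis using ef(1,2) by (blast intro: minus_eq_zero_imp_eq)
qed

section \<open>Consequences of unique cleanness\<close>

lemma uniquely_clean_unique:
  assumes "uniquely_clean R" "e \<in> idempotents R" "f \<in> idempotents R" "u \<in> Units R" "v \<in> Units R"
    and "e \<oplus> u = f \<oplus> v"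
  shows "e = f"
proof -
  have "e \<oplus> u \<in> carrier R" using assms by (auto simp: idempotents_def)
  then have "\<exists>!p. p \<in> idempotents R \<times> Units R \<and> e \<oplus> u = fst p \<oplus> snd p"
    using assms(1) unfolding uniquely_clean_def by blast
  moreover have "(e, u) \<in> idempotents R \<times> Units R \<and> e \<oplus> u = fst (e, u) \<oplus> snd (e, u)"
    using assms by simp
  moreover have "(f, v) \<in> idempotents R \<times> Units R \<and> e \<oplus> u = fst (f, v) \<oplus> snd (f, v)"
    using assms by simp
  ultimately have "(e, u) = (f, v)" by blast
  then show ?thesis by simp
qed

lemma uniquely_clean_exists:
  assumes "uniquely_clean R" "a \<in> carrier R"
  obtains e u where "e \<in> idempotents R" "u \<in> Units R" "a = e \<oplus> u"
  using assms unfolding uniquely_clean_def by (metis mem_Times_iff)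

lemma uniquely_clean_corner_eq_zero:
  assumes "uniquely_clean R" "e \<in> idempotents R" "x \<in> carrier R"
    and "e \<otimes> x \<oplus> x \<otimes> e = x" "x \<otimes> x = \<zero>"
  shows "x = \<zero>"
proof -
  have e: "e \<in> carrier R" using assms by (auto simp: idempotents_def)
  have "e \<oplus> (\<one> \<oplus> x) = (e \<oplus> x) \<oplus> \<one>" using e assms(3) by (simp add: ring_normalize)
  then have "e = e \<oplus> x"
    using uniquely_clean_unique[of e "e \<oplus> x" "\<one> \<oplus> x" \<one>] assms idempotent_plus_corner
      one_plus_square_zero_Units by simp
  then show ?thesis using e assms(3) by (metis add.l_cancel_one')
qed

text \<open>Both off-diagonal Peirce components of \<open>r\<close>, namely
  \<open>e r - e r e\<close> and \<open>r e - e r e\<close>, vanish, so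
  \<open>e r = e r e = r e\<close>.\<close>

lemma uniquely_clean_idempotents_central:
  assumes "uniquely_clean R"
  shows "idempotents R \<subseteq> ring_center R"
proof
  fix e assume e: "e \<in> idempotents R"
  then have ec: "e \<in> carrier R" and ee: "e \<otimes> e = e" by (auto simp: idempotents_def)
  have "e \<otimes> r = r \<otimes> e" if r: "r \<in> carrier R" for r
  proof -
    have e3: "e \<otimes> (e \<otimes> y) = e \<otimes> y" if "y \<in> carrier R" for y
      using ec ee that by (metis m_assoc)
    have ere: "e \<otimes> r \<otimes> e \<in> carrier R" using ec r by simp
    have "e \<otimes> r \<ominus> e \<otimes> r \<otimes> e = \<zero>"
    proof (rule uniquely_clean_corner_eq_zero[OF assms e])
      show "e \<otimes> (e \<otimes> r \<ominus> e \<otimes> r \<otimes> e) \<oplus> (e \<otimes> r \<ominus> e \<otimes> r \<otimes> e) \<otimes> e = e \<otimes> r \<ominus> e \<otimes> r \<otimes> e"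
        using ec r ere by (simp add: a_minus_def l_distr r_distr l_minus r_minus m_assoc ee e3 r_neg)
      show "(e \<otimes> r \<ominus> e \<otimes> r \<otimes> e) \<otimes> (e \<otimes> r \<ominus> e \<otimes> r \<otimes> e) = \<zero>"
        using ec r ere by (simp add: a_minus_def l_distr r_distr l_minus r_minus m_assoc ee e3 r_neg l_neg)
    qed (use ec r in simp)
    moreover have "r \<otimes> e \<ominus> e \<otimes> r \<otimes> e = \<zero>"
    proof (rule uniquely_clean_corner_eq_zero[OF assms e])
      show "e \<otimes> (r \<otimes> e \<ominus> e \<otimes> r \<otimes> e) \<oplus> (r \<otimes> e \<ominus> e \<otimes> r \<otimes> e) \<otimes> e = r \<otimes> e \<ominus> e \<otimes> r \<otimes> e"
        using ec r ere by (simp add: a_minus_def l_distr r_distr l_minus r_minus m_assoc ee e3 r_neg)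
      show "(r \<otimes> e \<ominus> e \<otimes> r \<otimes> e) \<otimes> (r \<otimes> e \<ominus> e \<otimes> r \<otimes> e) = \<zero>"
        using ec r ere by (simp add: a_minus_def l_distr r_distr l_minus r_minus m_assoc ee e3 r_neg l_neg)
    qed (use ec r in simp)
    ultimately show ?thesis using ec r ere minus_eq_zero_imp_eq by (metis m_closed)
  qed
  then show "e \<in> ring_center R" using ec by (simp add: ring_center_def)
qed

lemma uniquely_clean_Units_add_minus_one:
  assumes uc: "uniquely_clean R" and u: "u \<in> Units R" and v: "v \<in> Units R"
  shows "u \<oplus> v \<ominus> \<one> \<in> Units R"
proof -
  have uv: "u \<in> carrier R" "v \<in> carrier R" "inv v \<in> carrier R" "v \<otimes> inv v = \<one>" using u v by auto
  obtain g t where g: "g \<in> idempotents R" and t: "t \<in> Units R" and gt: "u \<oplus> v = g \<oplus> t"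
    using uniquely_clean_exists[OF uc, of "u \<oplus> v"] uv by auto
  \<comment> \<open>The aim is \<open>p = \<zero>\<close>: then \<open>g = \<one>\<close> and
    \<open>t\<close> is the element sought. Multiplying by \<open>p\<close> removes \<open>g\<close>
    from the equation.\<close>
  define p where "p = \<one> \<ominus> g"
  have p: "p \<in> idempotents R" using g by (simp add: p_def one_minus_idempotent)
  then have pcen: "p \<in> ring_center R" using uniquely_clean_idempotents_central[OF uc] by blast
  have gc: "g \<in> carrier R" "g \<otimes> g = g" using g by (auto simp: idempotents_def)
  have pc: "p \<in> carrier R" and tc: "t \<in> carrier R" using gc t by (auto simp: p_def)
  have pg: "p \<otimes> g = \<zero>" using gc by (simp add: p_def a_minus_def l_distr l_minus r_neg)
  have "p \<otimes> u \<oplus> p \<otimes> v = p \<otimes> g \<oplus> p \<otimes> t"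
    using gt pc uv gc tc by (metis r_distr)
  then have "p \<otimes> u \<oplus> p \<otimes> v = p \<otimes> t" using pg pc tc by simp
  \<comment> \<open>Multiplying by \<open>inv v\<close> normalizes the second summand to
    \<open>p\<close>, so that an idempotent plus a corner unit appears.\<close>
  then have "(p \<otimes> u \<oplus> p \<otimes> v) \<otimes> inv v = p \<otimes> t \<otimes> inv v" by simp
  then have pt: "p \<otimes> (u \<otimes> inv v) \<oplus> p = p \<otimes> (t \<otimes> inv v)"
    using pc uv tc by (simp add: l_distr m_assoc)
  have "p = \<zero>"
  \<comment> \<open>Filling up with \<open>\<one> \<ominus> p\<close> makes the corner units into
    units of the ring. One element then has clean decompositions with idempotents \<open>p\<close>
    and \<open>\<zero>\<close>.\<close>
  proof (rule uniquely_clean_unique[OF uc p])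
    show "\<zero> \<in> idempotents R" by (simp add: idempotents_def)
    show "p \<otimes> (u \<otimes> inv v) \<oplus> (\<one> \<ominus> p) \<in> Units R" "p \<otimes> (t \<otimes> inv v) \<oplus> (\<one> \<ominus> p) \<in> Units R"
      using u v t by (auto intro!: central_corner_Units[OF p pcen])
    show "p \<oplus> (p \<otimes> (u \<otimes> inv v) \<oplus> (\<one> \<ominus> p)) = \<zero> \<oplus> (p \<otimes> (t \<otimes> inv v) \<oplus> (\<one> \<ominus> p))"
      unfolding pt[symmetric] using pc uv(1,3) by (simp add: ring_normalize)
  qed
  then have g1: "g = \<one>" using gc(1) minus_eq_zero_imp_eq[of \<one> g] by (simp add: p_def)
  have "u \<oplus> v \<ominus> \<one> = t" unfolding gt g1 using tc by (simp add: ring_normalize)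
  then show ?thesis using t by simp
qed

text \<open>For a unit \<open>w\<close>, \<open>(u + v) w = u w + v w\<close> is again a sum of two
  units, so subtracting 1 leaves a unit.\<close>

lemma uniquely_clean_Units_add_Delta:
  assumes "uniquely_clean R" "u \<in> Units R" "v \<in> Units R"
  shows "u \<oplus> v \<in> Delta R"
proof -
  have "\<one> \<ominus> (u \<oplus> v) \<otimes> w \<in> Units R" if w: "w \<in> Units R" for w
  proof -
    have "\<ominus> (u \<otimes> w \<oplus> v \<otimes> w \<ominus> \<one>) \<in> Units R"
      using assms w by (blast intro: Units_a_inv uniquely_clean_Units_add_minus_one)
    moreover have "\<ominus> (u \<otimes> w \<oplus> v \<otimes> w \<ominus> \<one>) = \<one> \<ominus> (u \<oplus> v) \<otimes> w"
      using assms(2,3)[THEN Units_closed] Units_closed[OF w] by (simp add: ring_normalize)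
    ultimately show ?thesis by simp
  qed
  then show ?thesis using assms by (simp add: Delta_def Units_closed)
qed

lemma uniquely_clean_imp_strongly_Delta_clean:
  assumes "uniquely_clean R"
  shows "strongly_Delta_clean R"
  unfolding strongly_Delta_clean_def
proof
  fix a assume a: "a \<in> carrier R"
  obtain f u where f: "f \<in> idempotents R" and u: "u \<in> Units R" and fu: "a = f \<oplus> u"
    using uniquely_clean_exists[OF assms a] .
  have fc: "f \<in> carrier R" using f by (simp add: idempotents_def)
  let ?e = "\<one> \<ominus> f" and ?d = "(f \<oplus> f \<ominus> \<one>) \<oplus> u"
  have e: "?e \<in> idempotents R" using f by (rule one_minus_idempotent)
  have d: "?d \<in> Delta R"
    using assms f u by (intro uniquely_clean_Units_add_Delta two_idempotent_minus_one_Units)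
  have "a = ?e \<oplus> ?d" unfolding fu using fc Units_closed[OF u] by (simp add: ring_normalize)
  moreover have "?e \<otimes> ?d = ?d \<otimes> ?e"
    using uniquely_clean_idempotents_central[OF assms] e Delta_closed[OF d]
    unfolding ring_center_def by blast
  ultimately show "\<exists>e \<in> idempotents R. \<exists>d \<in> Delta R. a = e \<oplus> d \<and> e \<otimes> d = d \<otimes> e"
    using e d by blast
qed

section \<open>Uniqueness of clean decompositions from strong Delta-cleanness\<close>

lemma strongly_Delta_clean_Units_minus_one:
  assumes "strongly_Delta_clean R" "u \<in> Units R"
  shows "u \<ominus> \<one> \<in> Delta R"
proof -
  obtain e d where e: "e \<in> idempotents R" and d: "d \<in> Delta R" and ed: "u = e \<oplus> d"
    using assms unfolding strongly_Delta_clean_def by blast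
  have c: "e \<in> carrier R" "d \<in> carrier R" using e d by (auto simp: idempotents_def Delta_closed)
  \<comment> \<open>A unit shifted by an element of \<open>Delta R\<close> stays a unit, so the
    idempotent \<open>e\<close> is a unit and equals \<open>\<one>\<close>.\<close>
  have "\<ominus> d \<oplus> u = e" unfolding ed using c by (simp add: ring_normalize)
  then have "e \<in> Units R" using Delta_add_Units[OF Delta_a_inv[OF d] assms(2)] by simp
  then have e1: "e = \<one>" using e Units_idempotent_eq_one by blast
  have "u \<ominus> \<one> = d" unfolding ed e1 using c(2) by (simp add: ring_normalize)
  then show ?thesis using d by simp
qed

lemma strongly_Delta_clean_imp_uniquely_clean:
  assumes "strongly_Delta_clean R" "idempotents R \<subseteq> ring_center R"
  shows "uniquely_clean R"
  unfolding uniquely_clean_def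
proof
  fix a assume a: "a \<in> carrier R"
  obtain e d where e: "e \<in> idempotents R" and d: "d \<in> Delta R" and ed: "a = e \<oplus> d"
    using assms a unfolding strongly_Delta_clean_def by blast
  have c: "e \<in> carrier R" "d \<in> carrier R" using e d by (auto simp: idempotents_def Delta_closed)
  have 1: "\<one> \<ominus> e \<in> idempotents R" "d \<oplus> (e \<oplus> e \<ominus> \<one>) \<in> Units R"
    using e d by (auto intro: one_minus_idempotent two_idempotent_minus_one_Units Delta_add_Units)
  have 2: "a = (\<one> \<ominus> e) \<oplus> (d \<oplus> (e \<oplus> e \<ominus> \<one>))" unfolding ed using c by (simp add: ring_normalize)
  have unique: "f = g \<and> u = v"
    if f: "f \<in> idempotents R" and g: "g \<in> idempotents R" and u: "u \<in> Units R" and v: "v \<in> Units R"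
      and eq: "f \<oplus> u = g \<oplus> v" for f g u v
  proof -
    have fg: "f \<in> carrier R" "g \<in> carrier R" using f g by (auto simp: idempotents_def)
    have uv: "u \<in> carrier R" "v \<in> carrier R" using u v by auto
    \<comment> \<open>The equation gives \<open>f - g = v - u\<close>, and the right side is a
      difference of two elements of \<open>Delta R\<close>.\<close>
    have "(v \<ominus> \<one>) \<ominus> (u \<ominus> \<one>) \<in> Delta R"
      using assms(1) u v by (intro Delta_minus strongly_Delta_clean_Units_minus_one)
    also have "(v \<ominus> \<one>) \<ominus> (u \<ominus> \<one>) = (g \<oplus> v) \<ominus> g \<ominus> u" using fg uv by (simp add: ring_normalize)
    also have "\<dots> = f \<ominus> g" unfolding eq[symmetric] using fg uv by (simp add: ring_normalize)
    finally have "f \<ominus> g \<in> Delta R" .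
    moreover have "f \<otimes> g = g \<otimes> f" using assms(2) f fg by (auto simp: ring_center_def)
    ultimately have "f = g" using commuting_idempotents_eq f g by blast
    then show ?thesis using eq fg uv by simp
  qed
  let ?p = "(\<one> \<ominus> e, d \<oplus> (e \<oplus> e \<ominus> \<one>))"
  show "\<exists>!p. p \<in> idempotents R \<times> Units R \<and> a = fst p \<oplus> snd p"
  proof (rule ex1I[of _ ?p])
    show p: "?p \<in> idempotents R \<times> Units R \<and> a = fst ?p \<oplus> snd ?p"
      unfolding fst_conv snd_conv using 1 2 by blast
    fix q assume q: "q \<in> idempotents R \<times> Units R \<and> a = fst q \<oplus> snd q"
    have "fst q = fst ?p \<and> snd q = snd ?p"
      using p q by (intro unique) (auto simp only: mem_Times_iff)
    then show "q = ?p" by (simp only: prod_eq_iff)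
  qed
qed

end

theorem theorem3p2:
  fixes R :: "('a, 'b) ring_scheme"
  assumes "ring R"
  shows "uniquely_clean R \<longleftrightarrow> strongly_Delta_clean R \<and> idempotents R \<subseteq> ring_center R"
  using ring.uniquely_clean_imp_strongly_Delta_clean[OF assms]
    ring.uniquely_clean_idempotents_central[OF assms]
    ring.strongly_Delta_clean_imp_uniquely_clean[OF assms]
  by blast

end
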